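(* Let $\mathcal{M}=(E_t,\mathcal{T})$ be a simple oriented matroid of rank $r\geq 3$ on the ground set $E_t=\{1,2,\ldots,t\}$, with set of topes $\mathcal{T}\subseteq\{1,-1\}^{E_t}$, and let $\boldsymbol{R}$ be a symmetric $2t$-cycle in the tope graph of $\mathcal{M}$, with vertex set $\mathrm{V}(\boldsymbol{R})$. Let $T\in\mathcal{T}$ be a tope of $\mathcal{M}$ such that, for the unique inclusion-minimal subset of topes $\boldsymbol{Q}(T,\boldsymbol{R})\subset\mathrm{V}(\boldsymbol{R})$ with the property $$\sum_{Q\in\boldsymbol{Q}(T,\boldsymbol{R})}Q=T,$$ we have $|\boldsymbol{Q}(T,\boldsymbol{R})|\geq 5$. Let $\boldsymbol{\Lambda}:=\boldsymbol{\Lambda}(T,\boldsymbol{R})$ be the abstract simplicial complex on $E_t$ whose family of facets is $$\{E_t-\mathbf{S}(T,Q)\colon Q\in\boldsymbol{Q}(T,\boldsymbol{R})\},\qquad \mathbf{S}(T,Q):=\{e\in E_t\colon T(e)\neq Q(e)\},$$ and for $0\leq j\leq t$ let $f_j(\boldsymbol{\Lambda};t):=\#\{F\in\boldsymbol{\Lambda}\colon |F|=j\}$. Then $\boldsymbol{\Lambda}(T,\boldsymbol{R})=\boldsymbol{\Lambda}(-T,\boldsymbol{R})$, and the following hold. (i) The numbers $f_j(\boldsymbol{\Lambda};t)$ satisfy the relations $$f_j(\boldsymbol{\Lambda};t)=\binom{t}{j}\ \text{ if } 0\leq j\leq 2,\qquad f_{t-1}(\boldsymbol{\Lambda};t)=f_t(\boldsymbol{\Lambda};t)=0,$$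 $$\sum_{j=3}^t\left(\binom{t}{j}-f_j(\boldsymbol{\Lambda};t)\right)(\mathrm{x}-1)^{t-j}=-\sum_{j=3}^t(-1)^j\left(\binom{t}{j}-f_j(\boldsymbol{\Lambda};t)\right)\mathrm{x}^{t-j},$$ where $\mathrm{x}$ is a formal variable (the last relation is an identity of polynomials in $\mathrm{x}$). In particular: - if $t=5$, then $f_3(\boldsymbol{\Lambda};t)=\binom{t}{2}-t=5$; - if $t=6$, then $f_3(\boldsymbol{\Lambda};t)=\binom{t}{3}-2t+4=12$ and $f_4(\boldsymbol{\Lambda};t)=\binom{t}{2}-3t+6=3$; - if $t=7$, then $$f_3(\boldsymbol{\Lambda};t)=\tfrac{1}{2}f_4(\boldsymbol{\Lambda};t)+\binom{t}{4}-\tfrac{1}{2}\binom{t}{3}=\tfrac{1}{2}\bigl(f_4(\boldsymbol{\Lambda};t)+35\bigr),$$ $$f_3(\boldsymbol{\Lambda};t)=f_5(\boldsymbol{\Lambda};t)+\binom{t}{4}-\binom{t}{2}+t=f_5(\boldsymbol{\Lambda};t)+21,$$ $$f_4(\boldsymbol{\Lambda};t)=2f_3(\boldsymbol{\Lambda};t)-2\binom{t}{4}+\binom{t}{3}=2f_3(\boldsymbol{\Lambda};t)-35,$$ $$f_4(\boldsymbol{\Lambda};t)=2f_5(\boldsymbol{\Lambda};t)+\binom{t}{3}-2\binom{t}{2}+2t=2f_5(\boldsymbol{\Lambda};t)+7,$$ $$f_5(\boldsymbol{\Lambda};t)=f_3(\boldsymbol{\Lambda};t)-\binom{t}{4}+\binom{t}{2}-t=f_3(\boldsymbol{\Lambda};t)-21,$$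 $$f_5(\boldsymbol{\Lambda};t)=\tfrac{1}{2}f_4(\boldsymbol{\Lambda};t)-\tfrac{1}{2}\binom{t}{3}+\binom{t}{2}-t=\tfrac{1}{2}\bigl(f_4(\boldsymbol{\Lambda};t)-35\bigr)+14,$$ and the quantity $f_4(\boldsymbol{\Lambda};7)$ is odd. (ii) For any $j$ with $3\leq j\leq t-2$, we have $$\binom{t}{j}-f_j(\boldsymbol{\Lambda};t)=-\sum_{i=3}^j(-1)^i\binom{t-i}{j-i}\left(\binom{t}{i}-f_i(\boldsymbol{\Lambda};t)\right).$$ (iii) We have $$\sum_{j=1}^{t-2}(-1)^j f_j(\boldsymbol{\Lambda};t)=0.$$
   Context: An oriented matroid is simple if it has no loops, no parallel elements and no antiparallel elements. Its topes are its maximal covectors, regarded as vectors $T=(T(1),\ldots,T(t))\in\{1,-1\}^{E_t}\subset\mathbb{R}^t$; $-T$ is the negative of the tope $T$ (again a tope), and sums of topes are taken in $\mathbb{R}^t$. The tope graph has vertex set $\mathcal{T}$, two topes being adjacent if and only if they differ in exactly one component. A symmetric $2t$-cycle $\boldsymbol{R}$ in the tope graph is a cycle with $2t$ vertices whose vertex set satisfies $\mathrm{V}(\boldsymbol{R})=-\mathrm{V}(\boldsymbol{R})$. Known fact underlying the notation: for any tope $T\in\mathcal{T}$ and any symmetric $2t$-cycle $\boldsymbol{R}$ there exists a unique inclusion-minimal subset $\boldsymbol{Q}(T,\boldsymbol{R})\subset\mathrm{V}(\boldsymbol{R})$ such that $\sum_{Q\in\boldsymbol{Q}(T,\boldsymbol{R})}Q=T$.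 The abstract simplicial complex $\boldsymbol{\Lambda}(T,\boldsymbol{R})$ consists of all subsets $F\subseteq E_t$ (including the empty set) such that $F\subseteq E_t-\mathbf{S}(T,Q)$ for some $Q\in\boldsymbol{Q}(T,\boldsymbol{R})$, where $E_t-\mathbf{S}(T,Q)$ is the set difference. The vector $\boldsymbol{f}(\boldsymbol{\Lambda};t)=(f_0(\boldsymbol{\Lambda};t),\ldots,f_t(\boldsymbol{\Lambda};t))$ is the "long $f$-vector", indexed by the cardinality of faces. The complex $\boldsymbol{\Lambda}(-T,\boldsymbol{R})$ is defined in the same way from the tope $-T$ and the set $\boldsymbol{Q}(-T,\boldsymbol{R})$. *)

theory Defs
  imports "HOL-Analysis.Analysis" "HOL-Computational_Algebra.Polynomial"
begin

(* The ground set E_t is the finite index type 'n, so t = CARD('n); sign vectors are the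
   vectors of real ^ 'n with entries in {-1,0,1}, so that sums and negatives of topes are
   the ones of R^t. *)

subsection \<open>Oriented matroids given by covectors\<close>

definition sign_vectors :: "(real ^ 'n) set" where
  "sign_vectors = {X. \<forall>e. X $ e \<in> {-1, 0, 1}}"

definition composition :: "real ^ 'n \<Rightarrow> real ^ 'n \<Rightarrow> real ^ 'n" where
  "composition X Y = (\<chi> e. if X $ e \<noteq> 0 then X $ e else Y $ e)"

definition opposite_on :: "real ^ 'n \<Rightarrow> real ^ 'n \<Rightarrow> 'n set" where
  "opposite_on X Y = {e. X $ e \<noteq> 0 \<and> X $ e = - Y $ e}"

locale oriented_matroid =
  fixes L :: "(real ^ 'n) set"
  assumes signs: "L \<subseteq> sign_vectors"
    and zero: "0 \<in> L"
    and symmetry: "X \<in> L \<Longrightarrow> - X \<in> L"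
    and composition: "X \<in> L \<Longrightarrow> Y \<in> L \<Longrightarrow> composition X Y \<in> L"
    and elimination: "X \<in> L \<Longrightarrow> Y \<in> L \<Longrightarrow> e \<in> opposite_on X Y \<Longrightarrow>
      \<exists>Z\<in>L. Z $ e = 0 \<and> (\<forall>g. g \<notin> opposite_on X Y \<longrightarrow> Z $ g = composition X Y $ g)"

definition om_loop :: "(real ^ 'n) set \<Rightarrow> 'n \<Rightarrow> bool" where
  "om_loop L e \<longleftrightarrow> (\<forall>X\<in>L. X $ e = 0)"

definition om_parallel :: "(real ^ 'n) set \<Rightarrow> 'n \<Rightarrow> 'n \<Rightarrow> bool" where
  "om_parallel L e g \<longleftrightarrow> e \<noteq> g \<and> (\<forall>X\<in>L. X $ e = X $ g)"

definition om_antiparallel :: "(real ^ 'n) set \<Rightarrow> 'n \<Rightarrow> 'n \<Rightarrow> bool" where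
  "om_antiparallel L e g \<longleftrightarrow> e \<noteq> g \<and> (\<forall>X\<in>L. X $ e = - X $ g)"

definition simple_oriented_matroid :: "(real ^ 'n) set \<Rightarrow> bool" where
  "simple_oriented_matroid L \<longleftrightarrow> oriented_matroid L \<and> (\<forall>e. \<not> om_loop L e) \<and>
     (\<forall>e g. \<not> om_parallel L e g \<and> \<not> om_antiparallel L e g)"

(* The rank is that of the underlying matroid, whose flats are the zero sets of covectors. *)

definition om_flats :: "(real ^ 'n) set \<Rightarrow> 'n set set" where
  "om_flats L = {{e. X $ e = 0} | X. X \<in> L}"

definition om_closure :: "(real ^ 'n) set \<Rightarrow> 'n set \<Rightarrow> 'n set" where
  "om_closure L A = \<Inter>{F \<in> om_flats L. A \<subseteq> F}"

definition om_independent :: "(real ^ 'n) set \<Rightarrow> 'n set \<Rightarrow> bool" where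
  "om_independent L A \<longleftrightarrow> (\<forall>a\<in>A. a \<notin> om_closure L (A - {a}))"

definition om_rank :: "(real ^ 'n) set \<Rightarrow> nat" where
  "om_rank L = Max {card A | A. om_independent L A}"

definition conformal_le :: "real ^ 'n \<Rightarrow> real ^ 'n \<Rightarrow> bool" where
  "conformal_le X Y \<longleftrightarrow> (\<forall>e. X $ e = 0 \<or> X $ e = Y $ e)"

definition topes :: "(real ^ 'n) set \<Rightarrow> (real ^ 'n) set" where
  "topes L = {T \<in> L. \<forall>X\<in>L. conformal_le T X \<longrightarrow> X = T}"

subsection \<open>Symmetric cycles in the tope graph\<close>

definition tope_adj :: "(real ^ 'n) set \<Rightarrow> real ^ 'n \<Rightarrow> real ^ 'n \<Rightarrow> bool" where
  "tope_adj L T U \<longleftrightarrow> T \<in> topes L \<and> U \<in> topes L \<and> (\<exists>!e. T $ e \<noteq> U $ e)"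

(* A cycle is given by the list of its vertices in cyclic order. *)

definition graph_cycle :: "('a \<Rightarrow> 'a \<Rightarrow> bool) \<Rightarrow> 'a list \<Rightarrow> bool" where
  "graph_cycle adj vs \<longleftrightarrow> length vs \<ge> 3 \<and> distinct vs \<and>
     (\<forall>i<length vs. adj (vs ! i) (vs ! (Suc i mod length vs)))"

definition symmetric_cycle :: "(real ^ 'n) set \<Rightarrow> (real ^ 'n) list \<Rightarrow> bool" where
  "symmetric_cycle L R \<longleftrightarrow> graph_cycle (tope_adj L) R \<and> length R = 2 * CARD('n) \<and>
     set R = uminus ` set R"

subsection \<open>The decomposition of a tope and the associated complex\<close>

definition minimal_decomposition ::
    "real ^ 'n \<Rightarrow> (real ^ 'n) list \<Rightarrow> (real ^ 'n) set \<Rightarrow> bool" where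
  "minimal_decomposition T R Q \<longleftrightarrow>
     Q \<subseteq> set R \<and> \<Sum>Q = T \<and> (\<forall>Q'. Q' \<subset> Q \<longrightarrow> \<Sum>Q' \<noteq> T)"

(* For a tope T and a symmetric cycle R there is exactly one minimal decomposition. *)

definition decomposition :: "real ^ 'n \<Rightarrow> (real ^ 'n) list \<Rightarrow> (real ^ 'n) set" where
  "decomposition T R = (THE Q. minimal_decomposition T R Q)"

definition separation :: "real ^ 'n \<Rightarrow> real ^ 'n \<Rightarrow> 'n set" where
  "separation T Q = {e. T $ e \<noteq> Q $ e}"

definition Lambda_complex :: "real ^ 'n \<Rightarrow> (real ^ 'n) list \<Rightarrow> 'n set set" where
  "Lambda_complex T R = {F. \<exists>Q\<in>decomposition T R. F \<subseteq> UNIV - separation T Q}"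

(* Long f-vector: faces are counted by cardinality, not by dimension. *)

definition long_f_vector :: "'n set set \<Rightarrow> nat \<Rightarrow> nat" where
  "long_f_vector \<Delta> j = card {F \<in> \<Delta>. card F = j}"

end

theory Submission
  imports Defs
begin

text \<open>
Let \<open>n\<close> be the size of the ground set. Since antipodal vertices of the cycle have Hamming
distance \<open>n\<close>, and the cycle has only \<open>2n\<close> vertices, the vertex \<open>n\<close> steps after \<open>Q\<close> is \<open>- Q\<close>,
and each half of the cycle flips every coordinate exactly once
(\<open>symmetric_cycle_antipodal\<close>, \<open>flip_inj\<close>). Everything else is read off from the
agreement sets \<open>A\<^sub>k = {e. R\<^sub>k(e) = T(e)}\<close>: going once around the cycle,
they gain or lose one element at a time, each element belongs to \<open>n\<close> consecutive
ones, and \<open>A\<^sub>k\<^sub>+\<^sub>n\<close> is the complement of \<open>A\<^sub>k\<close>.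

The minimal decomposition of \<open>T\<close> consists of the vertices at which \<open>A\<^sub>k\<close> is
inclusion-maximal (\<open>decomposition_eq_peaks\<close>). Hence \<open>F\<close> is a face iff some vertex of the cycle,
in the decomposition or not, agrees with \<open>T\<close> on \<open>F\<close> (\<open>Lambda_complex_eq\<close>); in this
form the complex is visibly the same for \<open>T\<close> and \<open>- T\<close>. All sets with at most two elements are
faces. A face with at least \<open>n - 1\<close> elements would put \<open>T\<close> so close to the cycle that the
decomposition has at most three vertices (\<open>card_peaks_le_3\<close>).

The relations come from Euler characteristics. For a nonempty face \<open>G\<close>, the vertices agreeing
with \<open>T\<close> on \<open>G\<close> form a single arc, which is left exactly once; so faces can be counted by
counting exits from arcs (\<open>card_exits\<close>). Summing \<open>(-1)\<^bsup>|G|\<^esup>\<close> over the subsets of a nonface \<open>H\<close>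
one vertex of the cycle at a time, all contributions cancel, because a nonface meets every agreement set: the
complex restricted to \<open>H\<close> has the Euler characteristic of a circle
(\<open>nonface_euler_characteristic\<close>). Summing this over all \<open>H\<close> of size \<open>j\<close> gives (ii), for every
\<open>j\<close> (\<open>nonface_relations\<close>). The polynomial identity is the generating function of these relations,
(iii) is the one for \<open>j = n\<close>, and the values for \<open>n = 5, 6, 7\<close> follow from those with \<open>j = 4\<close> and
\<open>j = 6\<close>, where \<open>f\<^sub>n\<^sub>-\<^sub>1 = f\<^sub>n = 0\<close>.
\<close>

section \<open>Dehn-Sommerville relations from local Euler characteristics\<close>

lemma alternating_sum_Pow:
  assumes "finite S"
  shows "(\<Sum>G\<in>Pow S. (- 1 :: int) ^ card G) = of_bool (S = {})"
  using prod_diff_conv_sum[OF assms, of "\<lambda>_. 1 :: int" "\<lambda>_. 1"] assms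
  by (simp add: power_0_left split: if_splits)

lemma card_supersets:
  fixes G :: "'a :: finite set"
  assumes "card G \<le> j"
  shows "card {H. G \<subseteq> H \<and> card H = j} = (CARD('a) - card G) choose (j - card G)"
proof -
  have "bij_betw (\<lambda>K. G \<union> K) {K. K \<subseteq> - G \<and> card K = j - card G} {H. G \<subseteq> H \<and> card H = j}"
  proof (rule bij_betw_byWitness[where f' = "\<lambda>H. H - G"])
    show "(\<lambda>K. G \<union> K) ` {K. K \<subseteq> - G \<and> card K = j - card G} \<subseteq> {H. G \<subseteq> H \<and> card H = j}"
      using assms by (auto simp: card_Un_disjoint disjoint_eq_subset_Compl Int_commute)
    show "(\<lambda>H. H - G) ` {H. G \<subseteq> H \<and> card H = j} \<subseteq> {K. K \<subseteq> - G \<and> card K = j - card G}"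
      by (auto simp: card_Diff_subset)
  qed auto
  then have "card {H. G \<subseteq> H \<and> card H = j} = card {K. K \<subseteq> - G \<and> card K = j - card G}"
    by (simp add: bij_betw_same_card)
  also have "\<dots> = (CARD('a) - card G) choose (j - card G)"
    by (simp add: n_subsets Compl_eq_Diff_UNIV card_Diff_subset)
  finally show ?thesis .
qed

lemma long_f_vector_complement:
  fixes \<Delta> :: "'a :: finite set set"
  shows "int (CARD('a) choose j) - int (long_f_vector \<Delta> j) = int (card {F. F \<notin> \<Delta> \<and> card F = j})"
proof -
  have "CARD('a) choose j = card {F :: 'a set. card F = j}"
    using n_subsets[of "UNIV :: 'a set" j] by simp
  also have "{F :: 'a set. card F = j} = {F \<in> \<Delta>. card F = j} \<union> {F. F \<notin> \<Delta> \<and> card F = j}"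
    by auto
  also have "card \<dots> = long_f_vector \<Delta> j + card {F. F \<notin> \<Delta> \<and> card F = j}"
    unfolding long_f_vector_def by (rule card_Un_disjoint) auto
  finally show ?thesis by simp
qed

text \<open>
Both sides count pairs of a nonface \<open>G\<close> and a superset \<open>H\<close> of size \<open>j\<close>, weighted by
\<open>(-1)\<^bsup>|G|\<^esup>\<close>. Fixing \<open>G\<close> first gives the binomial coefficients; fixing \<open>H\<close> first gives \<open>-1\<close> for
each nonface \<open>H\<close>, and nothing for a face \<open>H\<close>, since all its subsets are faces.
\<close>

lemma nonface_relations:
  fixes \<Delta> :: "'a :: finite set set" and g :: "nat \<Rightarrow> int"
  assumes closed: "\<And>F G. F \<in> \<Delta> \<Longrightarrow> G \<subseteq> F \<Longrightarrow> G \<in> \<Delta>"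
    and euler: "\<And>H. H \<notin> \<Delta> \<Longrightarrow> (\<Sum>G | G \<subseteq> H \<and> G \<notin> \<Delta>. (- 1 :: int) ^ card G) = - 1"
    and g: "\<And>i. g i = int (CARD('a) choose i) - int (long_f_vector \<Delta> i)"
  shows "(\<Sum>i\<le>j. (- 1) ^ i * int ((CARD('a) - i) choose (j - i)) * g i) = - g j"
proof -
  have g: "g i = int (card {F. F \<notin> \<Delta> \<and> card F = i})" for i
    by (simp add: g long_f_vector_complement)
  have "(\<Sum>i\<le>j. (- 1) ^ i * int ((CARD('a) - i) choose (j - i)) * g i) =
      (\<Sum>i\<le>j. \<Sum>G \<in> {G \<in> {G. G \<notin> \<Delta> \<and> card G \<le> j}. card G = i}.
        (- 1) ^ card G * int (card {H. G \<subseteq> H \<and> card H = j}))"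
  proof (rule sum.cong[OF refl])
    fix i assume "i \<in> {..j}"
    then have "{G \<in> {G. G \<notin> \<Delta> \<and> card G \<le> j}. card G = i} = {G. G \<notin> \<Delta> \<and> card G = i}" by auto
    moreover have "(\<Sum>G | G \<notin> \<Delta> \<and> card G = i. (- 1 :: int) ^ card G * int (card {H. G \<subseteq> H \<and> card H = j}))
      = (\<Sum>G | G \<notin> \<Delta> \<and> card G = i. (- 1) ^ i * int ((CARD('a) - i) choose (j - i)))"
      using \<open>i \<in> {..j}\<close> by (intro sum.cong) (auto simp: card_supersets)
    ultimately show "(- 1) ^ i * int ((CARD('a) - i) choose (j - i)) * g i =
      (\<Sum>G \<in> {G \<in> {G. G \<notin> \<Delta> \<and> card G \<le> j}. card G = i}.
        (- 1) ^ card G * int (card {H. G \<subseteq> H \<and> card H = j}))"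
      by (simp add: g)
  qed
  also have "\<dots> = (\<Sum>G | G \<notin> \<Delta> \<and> card G \<le> j. (- 1) ^ card G * int (card {H. G \<subseteq> H \<and> card H = j}))"
    by (rule sum.group) auto
  also have "\<dots> = (\<Sum>G | G \<notin> \<Delta>. (- 1) ^ card G * int (card {H. G \<subseteq> H \<and> card H = j}))"
  proof (rule sum.mono_neutral_left)
    show "\<forall>G\<in>{G. G \<notin> \<Delta>} - {G. G \<notin> \<Delta> \<and> card G \<le> j}.
        (- 1 :: int) ^ card G * int (card {H. G \<subseteq> H \<and> card H = j}) = 0"
    proof
      fix G assume "G \<in> {G. G \<notin> \<Delta>} - {G. G \<notin> \<Delta> \<and> card G \<le> j}"
      then have "{H. G \<subseteq> H \<and> card H = j} = {}" using card_mono[of _ G] by force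
      then show "(- 1 :: int) ^ card G * int (card {H. G \<subseteq> H \<and> card H = j}) = 0"
        by (simp only: card.empty)
    qed
  qed auto
  also have "\<dots> = (\<Sum>G\<in>{G. G \<notin> \<Delta>}. \<Sum>H \<in> {H \<in> {H. card H = j}. G \<subseteq> H}. (- 1) ^ card G)"
    by (simp add: mult.commute conj_commute)
  also have "\<dots> = (\<Sum>H\<in>{H. card H = j}. \<Sum>G \<in> {G \<in> {G. G \<notin> \<Delta>}. G \<subseteq> H}. (- 1) ^ card G)"
    by (rule sum.swap_restrict) auto
  also have "\<dots> = (\<Sum>H\<in>{H. card H = j}. if H \<notin> \<Delta> then - 1 else 0)"
  proof (rule sum.cong[OF refl])
    fix H :: "'a set"
    have "{G \<in> {G. G \<notin> \<Delta>}. G \<subseteq> H} = (if H \<in> \<Delta> then {} else {G. G \<subseteq> H \<and> G \<notin> \<Delta>})"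
      using closed by auto
    then show "(\<Sum>G \<in> {G \<in> {G. G \<notin> \<Delta>}. G \<subseteq> H}. (- 1 :: int) ^ card G) =
        (if H \<notin> \<Delta> then - 1 else 0)"
      using euler by simp
  qed
  also have "\<dots> = - g j"
    by (simp add: g sum.If_cases Int_def conj_commute)
  finally show ?thesis .
qed

lemma smult_sum_right: "smult c (\<Sum>i\<in>S. p i) = (\<Sum>i\<in>S. smult c (p i))"
  by (induction S rule: infinite_finite_induct) (simp_all add: smult_add_right)

text \<open>
The substitution \<open>x \<mapsto> x - 1\<close> acts on coefficients by the signed binomial matrix of the hypothesis:
the coefficient of \<open>x\<^bsup>t - j\<^esup>\<close> on the left collects the terms \<open>i \<le> j\<close>.
\<close>

lemma polynomial_reflection:
  fixes g :: "nat \<Rightarrow> int"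
  assumes "\<And>j. j \<le> t \<Longrightarrow> (\<Sum>i\<le>j. (- 1) ^ i * int ((t - i) choose (j - i)) * g i) = - g j"
  shows "(\<Sum>j\<le>t. smult (g j) ([:-1, 1:] ^ (t - j))) =
    - (\<Sum>j\<le>t. smult ((- 1) ^ j * g j) ([:0, 1:] ^ (t - j)))"
proof -
  define X :: "int poly" where "X = [:0, 1:]"
  define a where "a i k = smult (g i * ((- 1) ^ k * int ((t - i) choose k))) (X ^ (t - (i + k)))" for i k
  have X: "[:-1, 1:] = - 1 + X" by (simp add: X_def one_pCons)
  have "smult (g i) ([:-1, 1:] ^ (t - i)) = (\<Sum>k\<le>t - i. a i k)" for i
  proof -
    have "[:-1, 1:] ^ (t - i) = (\<Sum>k\<le>t - i. smult ((- 1) ^ k * int ((t - i) choose k)) (X ^ (t - (i + k))))"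
      unfolding X binomial_ring
      by (intro sum.cong) (simp_all add: of_nat_poly minus_one_power_iff flip: diff_diff_left)
    then show ?thesis by (simp add: a_def smult_sum_right)
  qed
  then have "(\<Sum>i\<le>t. smult (g i) ([:-1, 1:] ^ (t - i))) = (\<Sum>i\<le>t. \<Sum>k\<le>t - i. a i k)" by simp
  also have "\<dots> = (\<Sum>(i, k)\<in>{(i, k). i + k \<le> t}. a i k)"
    by (subst sum.Sigma) (auto intro!: sum.cong)
  also have "\<dots> = (\<Sum>j\<le>t. \<Sum>i\<le>j. a i (j - i))" by (rule sum.triangle_reindex_eq)
  also have "\<dots> = (\<Sum>j\<le>t. - smult ((- 1) ^ j * g j) (X ^ (t - j)))"
  proof (rule sum.cong[OF refl])
    fix j assume "j \<in> {..t}"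
    have "(\<Sum>i\<le>j. a i (j - i)) =
        (\<Sum>i\<le>j. smult ((- 1) ^ j * ((- 1) ^ i * int ((t - i) choose (j - i)) * g i)) (X ^ (t - j)))"
    proof (rule sum.cong[OF refl])
      fix i assume "i \<in> {..j}"
      then obtain d where "j = i + d" by (auto simp: le_iff_add)
      then have "(- 1 :: int) ^ (j - i) = (- 1) ^ j * (- 1) ^ i"
        by (simp add: power_add mult_ac)
      then show "a i (j - i) =
          smult ((- 1) ^ j * ((- 1) ^ i * int ((t - i) choose (j - i)) * g i)) (X ^ (t - j))"
        using \<open>i \<in> {..j}\<close> by (simp add: a_def mult_ac)
    qed
    also have "\<dots> = smult ((- 1) ^ j * (\<Sum>i\<le>j. (- 1) ^ i * int ((t - i) choose (j - i)) * g i)) (X ^ (t - j))"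
      by (simp add: smult_sum sum_distrib_left)
    also have "\<dots> = - smult ((- 1) ^ j * g j) (X ^ (t - j))"
      using assms \<open>j \<in> {..t}\<close> by simp
    finally show "(\<Sum>i\<le>j. a i (j - i)) = - smult ((- 1) ^ j * g j) (X ^ (t - j))" .
  qed
  finally show ?thesis by (simp add: sum_negf X_def)
qed

section \<open>Symmetric cycles of sign vectors\<close>

lemma residue_offset:
  fixes N k m :: nat
  assumes "N > 0"
  obtains i where "i < N" "(k + i) mod N = m mod N"
proof
  have "k \<le> m + N * k" using assms by (cases N) auto
  then have "k + (m + N * k - k) = m + N * k" by (rule le_add_diff_inverse)
  then show "(k + (m + N * k - k) mod N) mod N = m mod N"
    by (metis mod_add_right_eq mod_mult_self2)
qed (use assms in simp)

text \<open>
The cycle is unrolled to a sequence indexed by all natural numbers, so that steps past the end of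
one period need no modular arithmetic.
\<close>

locale antipodal_cycle =
  fixes r :: "nat \<Rightarrow> real ^ 'n"
  assumes vertex_sign: "r k $ e = 1 \<or> r k $ e = - 1"
    and antipode: "r (k + CARD('n)) = - r k"
    and unique_flip: "\<exists>!e. r k $ e \<noteq> r (Suc k) $ e"
begin

definition flip :: "nat \<Rightarrow> 'n" where
  "flip k = (THE e. r k $ e \<noteq> r (Suc k) $ e)"

lemma flip_iff: "r k $ e \<noteq> r (Suc k) $ e \<longleftrightarrow> e = flip k"
proof -
  have "r k $ flip k \<noteq> r (Suc k) $ flip k"
    unfolding flip_def by (rule theI'[OF unique_flip])
  then show ?thesis using unique_flip[of k] by blast
qed

lemma vertex_Suc: "r (Suc k) $ e = (if e = flip k then - r k $ e else r k $ e)"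
  using flip_iff[of k e] vertex_sign[of k e] vertex_sign[of "Suc k" e] by auto

lemma vertex_nonzero: "r k $ e \<noteq> 0"
  using vertex_sign[of k e] by auto

lemma vertex_period: "r (k + 2 * CARD('n)) = r k"
  using antipode[of k] antipode[of "k + CARD('n)"] by (simp add: mult_2 add.assoc)

lemma vertex_period_mult: "r (k + 2 * CARD('n) * m) = r k"
proof (induction m)
  case (Suc m)
  have "r (k + 2 * CARD('n) * Suc m) = r ((k + 2 * CARD('n) * m) + 2 * CARD('n))"
    by (simp add: algebra_simps)
  then show ?case using vertex_period Suc by simp
qed simp

lemma flip_antipode: "flip (k + CARD('n)) = flip k"
  using flip_iff[of k "flip (k + CARD('n))"] flip_iff[of "k + CARD('n)" "flip (k + CARD('n))"]
    antipode[of k] antipode[of "Suc k"] by simp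

lemma vertex_unflipped:
  assumes "e \<notin> flip ` {k..<k + i}"
  shows "r (k + i) $ e = r k $ e"
  using assms
proof (induction i)
  case (Suc i)
  then have "e \<noteq> flip (k + i)" "e \<notin> flip ` {k..<k + i}" by auto
  then show ?case using Suc.IH vertex_Suc[of "k + i" e] by simp
qed simp

lemma flip_surj: "flip ` {k..<k + CARD('n)} = UNIV"
  using vertex_unflipped[of _ k "CARD('n)"] antipode[of k] vertex_nonzero[of k] by auto

text \<open>
The \<open>n\<close> steps from a vertex to its antipode must change each of the \<open>n\<close> coordinates, and each
step changes only one; so none is changed twice.
\<close>

lemma flip_inj: "inj_on flip {k..<k + CARD('n)}"
  by (rule eq_card_imp_inj_on) (simp_all add: flip_surj)

lemma vertex_after_flip:
  assumes "i < CARD('n)"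
  shows "r (Suc k + i) $ flip k = r (Suc k) $ flip k"
proof (rule vertex_unflipped)
  show "flip k \<notin> flip ` {Suc k..<Suc k + i}"
  proof
    assume "flip k \<in> flip ` {Suc k..<Suc k + i}"
    then obtain j where j: "flip k = flip j" "Suc k \<le> j" "j < Suc k + i" by auto
    with assms have "k = j"
      using inj_onD[OF flip_inj[of k], of k j] by auto
    with j show False by simp
  qed
qed

lemma vertex_after_second_flip:
  assumes "CARD('n) \<le> i" "i < 2 * CARD('n)"
  shows "r (Suc k + i) $ flip k = - r (Suc k) $ flip k"
proof -
  have "r (Suc k + i) = - r (Suc k + (i - CARD('n)))"
    using antipode[of "Suc k + (i - CARD('n))"] assms by simp
  moreover have "r (Suc k + (i - CARD('n))) $ flip k = r (Suc k) $ flip k"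
    by (rule vertex_after_flip) (use assms in auto)
  ultimately show ?thesis by simp
qed

lemma vertex_between:
  obtains i where "i < 2 * CARD('n)" "r m = r (k + i)" "flip m = flip (k + i)"
proof -
  define N where "N = 2 * CARD('n)"
  obtain i where i: "i < N" "(k + i) mod N = m mod N"
    using residue_offset[of N k m] by (auto simp: N_def)
  have r: "r (a mod N) = r a" for a
    using vertex_period_mult[of "a mod N" "a div N"] by (simp add: N_def)
  have "r (Suc (a mod N)) = r (Suc a)" for a
    using r[of "Suc a"] r[of "Suc (a mod N)"] by (simp add: mod_Suc_eq)
  then have f: "flip (a mod N) = flip a" for a
    using r by (simp add: flip_def)
  show thesis
    by (rule that[of i]) (use r f i in \<open>metis N_def\<close>)+
qed

text \<open>
After the flip of a coordinate its new sign persists for \<open>n\<close> steps, and before a flip the old sign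
has persisted for \<open>n\<close> steps. Two half-turns, one starting and the other ending at the same
vertex, share nothing but that vertex.
\<close>

lemma vertex_determined_at_corner:
  assumes "r m $ flip k = r (Suc k) $ flip k"
    and "r m $ flip (Suc k) = r (Suc k) $ flip (Suc k)"
  shows "r m = r (Suc k)"
proof -
  obtain i where i: "i < 2 * CARD('n)" "r m = r (Suc k + i)" by (rule vertex_between)
  have "i < CARD('n)"
    using assms(1) i vertex_after_second_flip[of i k] vertex_nonzero[of "Suc k" "flip k"]
    by (cases "i < CARD('n)") auto
  moreover have "i = 0"
  proof (rule ccontr)
    assume "i \<noteq> 0"
    then have "r m $ flip (Suc k) = r (Suc (Suc k)) $ flip (Suc k)"
      using vertex_after_flip[of "i - 1" "Suc k"] i \<open>i < CARD('n)\<close> by simp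
    then show False
      using assms(2) vertex_Suc[of "Suc k" "flip (Suc k)"] vertex_nonzero[of "Suc k"] by simp
  qed
  ultimately show ?thesis using i by simp
qed

text \<open>
A coordinate is flipped only twice in a full turn, in opposite directions.
\<close>

lemma vertex_determined_by_flip:
  assumes "flip k = flip m" "r (Suc k) $ flip k = r (Suc m) $ flip k"
  shows "r (Suc k) = r (Suc m)"
proof -
  obtain i where i: "i < 2 * CARD('n)" "r m = r (k + i)" "flip m = flip (k + i)"
    by (rule vertex_between)
  have "i < CARD('n)"
  proof (rule ccontr)
    assume "\<not> i < CARD('n)"
    then obtain l where l: "i = l + CARD('n)" by (metis add.commute le_Suc_ex not_less)
    have "flip (k + l) = flip k"
      using flip_antipode[of "k + l"] i(3) l assms(1) by (simp add: add.assoc)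
    then have "l = 0"
      using inj_onD[OF flip_inj[of k], of k "k + l"] i(1) l by auto
    then have "r m = - r k" using antipode[of k] i(2) l by simp
    then show False
      using assms vertex_Suc[of m "flip m"] vertex_Suc[of k "flip k"] vertex_nonzero[of k "flip k"]
      by simp
  qed
  then have "i = 0"
    using inj_onD[OF flip_inj[of k], of k "k + i"] i(3) assms(1) by auto
  then show ?thesis
    using i assms(1) by (simp add: vec_eq_iff vertex_Suc)
qed

end

section \<open>Agreement of a sign vector with the vertices of the cycle\<close>

locale antipodal_cycle_with_sign_vector = antipodal_cycle r
  for r :: "nat \<Rightarrow> real ^ 'n" +
  fixes T :: "real ^ 'n"
  assumes T_sign: "T $ e = 1 \<or> T $ e = - 1"
begin

definition agreement :: "real ^ 'n \<Rightarrow> 'n set" where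
  "agreement Q = {e. Q $ e = T $ e}"

definition agreement_complex :: "'n set set" where
  "agreement_complex = {F. \<exists>k. F \<subseteq> agreement (r k)}"

lemma agreement_antipode: "agreement (r (k + CARD('n))) = - agreement (r k)"
proof -
  have "- r k $ e = T $ e \<longleftrightarrow> r k $ e \<noteq> T $ e" for e
    using vertex_sign[of k e] T_sign[of e] by auto
  then show ?thesis by (auto simp: agreement_def antipode)
qed

lemma agreement_Suc:
  "e \<in> agreement (r (Suc k)) \<longleftrightarrow> (e \<in> agreement (r k) \<longleftrightarrow> e \<noteq> flip k)"
  using vertex_sign[of k e] T_sign[of e] by (auto simp: agreement_def vertex_Suc)

lemma agreement_after_flip:
  "i < CARD('n) \<Longrightarrow> flip k \<in> agreement (r (Suc k + i)) \<longleftrightarrow> flip k \<in> agreement (r (Suc k))"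
  using vertex_after_flip[of i k] by (simp add: agreement_def)

lemma agreement_inj:
  assumes "agreement (r k) = agreement (r m)"
  shows "r k = r m"
proof -
  have "r k $ e = r m $ e" for e
  proof -
    have "r k $ e = T $ e \<longleftrightarrow> r m $ e = T $ e"
      using assms by (auto simp: agreement_def)
    then show ?thesis
      using vertex_sign[of k e] vertex_sign[of m e] T_sign[of e] by auto
  qed
  then show ?thesis by (simp add: vec_eq_iff)
qed

subsection \<open>Faces with at most two elements\<close>

text \<open>
When \<open>a\<close> is flipped, the status of \<open>b\<close> stays the same. So \<open>T\<close> agrees on both elements on one
side of this step, or disagrees on both; in the second case the antipodal vertex agrees on both.
\<close>

lemma pair_in_agreement_complex: "{a, b} \<in> agreement_complex"
proof -
  obtain k where k: "a = flip k" using flip_surj[of 0] by (metis UNIV_I imageE)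
  have b: "b \<in> agreement (r (Suc k)) \<longleftrightarrow> b \<in> agreement (r k)" if "b \<noteq> a"
    using agreement_Suc[of b k] k that by auto
  have a: "a \<in> agreement (r (Suc k)) \<longleftrightarrow> a \<notin> agreement (r k)"
    using agreement_Suc[of a k] k by auto
  have "\<exists>m. a \<in> agreement (r m) \<and> b \<in> agreement (r m)"
    using a b agreement_antipode[of k] agreement_antipode[of "Suc k"] by (metis ComplI)
  then show ?thesis by (auto simp: agreement_complex_def)
qed

lemma small_sets_in_agreement_complex:
  assumes "card F \<le> 2"
  shows "F \<in> agreement_complex"
proof -
  consider "card F = 0" | "card F = 1" | "card F = 2" using assms by linarith
  then obtain a b where "F \<subseteq> {a, b}"
    by cases (auto simp: card_1_singleton_iff card_2_iff)
  then show ?thesis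
    using pair_in_agreement_complex[of a b] by (auto simp: agreement_complex_def)
qed

subsection \<open>The local Euler characteristic\<close>

text \<open>
The vertices agreeing with \<open>T\<close> on \<open>G\<close> form arcs of the cycle; \<open>exits G\<close> marks the last vertex
of each of them.
\<close>

definition exits :: "'n set \<Rightarrow> nat set" where
  "exits G = {k \<in> {..<2 * CARD('n)}. G \<subseteq> agreement (r k) \<and> \<not> G \<subseteq> agreement (r (Suc k))}"

lemma exits_flip:
  assumes "k \<in> exits G"
  shows "flip k \<in> G" "flip k \<notin> agreement (r (Suc k))"
  using assms agreement_Suc[of _ k] by (auto simp: exits_def subset_iff)

text \<open>
At an exit \<open>k\<close> an element of \<open>G\<close> begins \<open>n\<close> steps of disagreement, so a second exit \<open>m\<close> is
more than \<open>n\<close> steps later. For the same reason the return from \<open>m\<close> to \<open>k\<close> takes more than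
\<open>n\<close> steps, which is too much for one full turn.
\<close>

lemma exits_not_less:
  assumes k: "k \<in> exits G" and m: "m \<in> exits G"
  shows "\<not> k < m"
proof
  assume "k < m"
  have G: "G \<subseteq> agreement (r k)" "G \<subseteq> agreement (r m)" and m_less: "m < 2 * CARD('n)"
    using k m by (auto simp: exits_def)
  have ge: "m \<ge> Suc k + CARD('n)"
  proof (rule ccontr)
    assume "\<not> m \<ge> Suc k + CARD('n)"
    then have "m - Suc k < CARD('n)" "Suc k + (m - Suc k) = m" using \<open>k < m\<close> by linarith+
    then show False
      using agreement_after_flip[of "m - Suc k" k] exits_flip[OF k] G by auto
  qed
  then have "flip m \<notin> agreement (r (k + 2 * CARD('n)))"
    using agreement_after_flip[of "k + 2 * CARD('n) - Suc m" m] exits_flip(2)[OF m] m_less by auto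
  then show False
    using G exits_flip(1)[OF m] by (auto simp: vertex_period)
qed

text \<open>
An arc cannot fill the whole cycle: \<open>T\<close> disagrees on all of \<open>G\<close> at the antipode.
\<close>

lemma exits_nonempty:
  assumes "G \<noteq> {}" "G \<in> agreement_complex"
  shows "exits G \<noteq> {}"
proof -
  obtain k where k: "G \<subseteq> agreement (r k)" using assms by (auto simp: agreement_complex_def)
  have "\<not> G \<subseteq> agreement (r (k + CARD('n)))"
    using k assms agreement_antipode[of k] by auto
  then obtain i where "G \<subseteq> agreement (r (k + i))" "\<not> G \<subseteq> agreement (r (Suc (k + i)))"
    using k nat_induct[of "\<lambda>i. G \<subseteq> agreement (r (k + i))"] by force
  moreover obtain j where j: "j < 2 * CARD('n)" "r (k + i) = r (0 + j)" "flip (k + i) = flip (0 + j)"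
    by (rule vertex_between)
  moreover have "r (Suc (k + i)) = r (Suc j)" using j by (simp add: vec_eq_iff vertex_Suc)
  ultimately have "j \<in> exits G" by (auto simp: exits_def)
  then show ?thesis by auto
qed

lemma card_exits: "card (exits G) = of_bool (G \<noteq> {} \<and> G \<in> agreement_complex)"
proof (cases "G \<noteq> {} \<and> G \<in> agreement_complex")
  case True
  then obtain k where "k \<in> exits G" using exits_nonempty by auto
  moreover have "m = k" if "m \<in> exits G" for m
    using exits_not_less[of k G m] exits_not_less[of m G k] that \<open>k \<in> exits G\<close> by linarith
  ultimately have "exits G = {k}" by blast
  then show ?thesis using True by simp
next
  case False
  then have "exits G = {}" by (auto simp: exits_def agreement_complex_def)
  then show ?thesis using False by simp
qed

text \<open>
By \<open>card_exits\<close>, the signed count of the nonempty faces inside \<open>H\<close> is a sum over the vertices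
\<open>k\<close>, in which \<open>k\<close> contributes the subsets of \<open>H\<close> that lie in its agreement set but not in the
next one. This is the difference of two alternating sums over power sets. Both vanish, since neither
\<open>H \<inter> A\<^sub>k\<close> nor \<open>H \<inter> A\<^sub>k \<inter> A\<^sub>k\<^sub>+\<^sub>1\<close> is empty.
\<close>

lemma nonface_euler_characteristic:
  assumes H: "H \<notin> agreement_complex"
  shows "(\<Sum>G | G \<subseteq> H \<and> G \<notin> agreement_complex. (- 1 :: int) ^ card G) = - 1"
proof -
  \<comment> \<open>Otherwise \<open>H\<close> would lie in the agreement set of the antipode.\<close>
  have meets: "H \<inter> agreement (r k) \<noteq> {}" for k
    using H agreement_antipode[of k] by (force simp: agreement_complex_def)
  \<comment> \<open>Of two consecutive agreement sets one contains the other.\<close>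
  have meets2: "H \<inter> agreement (r k) \<inter> agreement (r (Suc k)) \<noteq> {}" for k
    using meets[of k] meets[of "Suc k"] agreement_Suc[of _ k] by blast
  have H0: "H \<noteq> {}" using meets by auto
  have step: "(\<Sum>G\<in>{G \<in> Pow H. k \<in> exits G}. (- 1 :: int) ^ card G) = 0" if "k < 2 * CARD('n)" for k
  proof -
    let ?A = "H \<inter> agreement (r k)" and ?B = "H \<inter> agreement (r k) \<inter> agreement (r (Suc k))"
    have "{G \<in> Pow H. k \<in> exits G} = Pow ?A - Pow ?B" using that by (auto simp: exits_def)
    then have "(\<Sum>G\<in>{G \<in> Pow H. k \<in> exits G}. (- 1 :: int) ^ card G) =
        (\<Sum>G\<in>Pow ?A. (- 1) ^ card G) - (\<Sum>G\<in>Pow ?B. (- 1) ^ card G)"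
      by (simp only:) (rule sum_diff, auto)
    also have "\<dots> = of_bool (?A = {}) - of_bool (?B = {})"
      by (simp only: alternating_sum_Pow[OF finite])
    finally show ?thesis
      using meets[of k] meets2[of k] by simp
  qed
  have "(\<Sum>G\<in>Pow H. (- 1 :: int) ^ card G * int (card (exits G))) =
      (\<Sum>G\<in>Pow H. \<Sum>k\<in>{k \<in> {..<2 * CARD('n)}. k \<in> exits G}. (- 1) ^ card G)"
    by (intro sum.cong refl) (simp add: exits_def mult.commute)
  also have "\<dots> = (\<Sum>k<2 * CARD('n). \<Sum>G\<in>{G \<in> Pow H. k \<in> exits G}. (- 1) ^ card G)"
    by (rule sum.swap_restrict) auto
  also have "\<dots> = 0" using step by simp
  finally have faces: "(\<Sum>G\<in>Pow H. (- 1 :: int) ^ card G * int (card (exits G))) = 0" .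
  have empty: "{} \<in> agreement_complex" by (auto simp: agreement_complex_def)
  have "0 = (\<Sum>G\<in>Pow H. (- 1 :: int) ^ card G)"
    using H0 by (simp add: alternating_sum_Pow)
  also have "\<dots> = (\<Sum>G\<in>Pow H. (- 1 :: int) ^ card G * int (card (exits G)) +
      ((- 1) ^ card G * of_bool (G = {}) + (- 1) ^ card G * of_bool (G \<notin> agreement_complex)))"
    using empty by (intro sum.cong) (auto simp: card_exits)
  also have "\<dots> = (\<Sum>G\<in>Pow H. (- 1 :: int) ^ card G * of_bool (G = {})) +
      (\<Sum>G\<in>Pow H. (- 1) ^ card G * of_bool (G \<notin> agreement_complex))"
    by (simp add: sum.distrib faces)
  also have "(\<Sum>G\<in>Pow H. (- 1 :: int) ^ card G * of_bool (G = {})) = (\<Sum>G\<in>{{} :: 'n set}. 1)"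
    by (rule sum.mono_neutral_cong_right) auto
  also have "(\<Sum>G\<in>Pow H. (- 1 :: int) ^ card G * of_bool (G \<notin> agreement_complex)) =
      (\<Sum>G | G \<subseteq> H \<and> G \<notin> agreement_complex. (- 1) ^ card G)"
    by (rule sum.mono_neutral_cong_right) auto
  finally show ?thesis by simp
qed

subsection \<open>The decomposition of the sign vector\<close>

text \<open>
Defined by global maximality, so that being a peak does not refer to a position in the sequence;
\<open>peak_iff\<close> shows that it suffices to compare with the two neighbours.
\<close>

definition peaks :: "(real ^ 'n) set" where
  "peaks = {Q \<in> range r. \<forall>Q' \<in> range r. agreement Q \<subseteq> agreement Q' \<longrightarrow> Q' = Q}"

lemma finite_range: "finite (range r)"
proof -
  have "range r \<subseteq> r ` {..<2 * CARD('n)}"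
  proof
    fix Q assume "Q \<in> range r"
    then obtain m where "Q = r m" by auto
    moreover obtain i where "i < 2 * CARD('n)" "r m = r (0 + i)" by (rule vertex_between)
    ultimately show "Q \<in> r ` {..<2 * CARD('n)}" by auto
  qed
  then show ?thesis by (rule finite_subset) simp
qed

lemma vertex_Suc_cases:
  assumes "Q \<in> range r"
  obtains k where "Q = r (Suc k)"
proof -
  obtain m where "Q = r m" using assms by auto
  \<comment> \<open>One full turn later, the vertex certainly has a predecessor.\<close>
  then have "Q = r (Suc (m + (2 * CARD('n) - 1)))" using vertex_period[of m] by simp
  then show thesis by (rule that)
qed

lemma peak_iff:
  "r (Suc k) \<in> peaks \<longleftrightarrow> flip k \<in> agreement (r (Suc k)) \<and> flip (Suc k) \<in> agreement (r (Suc k))"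
proof
  assume peak: "r (Suc k) \<in> peaks"
  have "r k \<noteq> r (Suc k)" "r (Suc (Suc k)) \<noteq> r (Suc k)"
    using flip_iff[of k "flip k"] flip_iff[of "Suc k" "flip (Suc k)"] by auto
  then have "\<not> agreement (r (Suc k)) \<subseteq> agreement (r k)"
      "\<not> agreement (r (Suc k)) \<subseteq> agreement (r (Suc (Suc k)))"
    using peak by (auto simp: peaks_def)
  then show "flip k \<in> agreement (r (Suc k)) \<and> flip (Suc k) \<in> agreement (r (Suc k))"
    using agreement_Suc[of _ k] agreement_Suc[of _ "Suc k"] by blast
next
  assume "flip k \<in> agreement (r (Suc k)) \<and> flip (Suc k) \<in> agreement (r (Suc k))"
  then show "r (Suc k) \<in> peaks"
    using vertex_determined_at_corner[of _ k] by (auto simp: peaks_def agreement_def subset_iff)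
qed

lemma opposite_peak_iff:
  "- r (Suc k) \<in> peaks \<longleftrightarrow> flip k \<notin> agreement (r (Suc k)) \<and> flip (Suc k) \<notin> agreement (r (Suc k))"
  using peak_iff[of "k + CARD('n)"] antipode[of "Suc k"] agreement_antipode[of "Suc k"]
    flip_antipode[of k] flip_antipode[of "Suc k"] by simp

lemma agreement_complex_eq_peaks: "agreement_complex = {F. \<exists>Q\<in>peaks. F \<subseteq> agreement Q}"
proof -
  have "\<exists>Q\<in>peaks. F \<subseteq> agreement Q" if F: "F \<subseteq> agreement (r k)" for F k
  proof -
    have bound: "\<forall>k. F \<subseteq> agreement (r k) \<longrightarrow> card (agreement (r k)) < Suc (CARD('n))"
      by (simp add: card_mono less_Suc_eq_le)
    obtain m where m: "F \<subseteq> agreement (r m)"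
      and max: "\<And>j. F \<subseteq> agreement (r j) \<Longrightarrow> card (agreement (r j)) \<le> card (agreement (r m))"
      using ex_has_greatest_nat[of "\<lambda>k. F \<subseteq> agreement (r k)", OF F bound] by blast
    have "r j = r m" if "agreement (r m) \<subseteq> agreement (r j)" for j
    proof (rule agreement_inj)
      have "F \<subseteq> agreement (r j)" using m that by blast
      then show "agreement (r j) = agreement (r m)"
        using max[of j] that by (metis card_seteq finite)
    qed
    then have "r m \<in> peaks" by (auto simp: peaks_def)
    then show ?thesis using m by blast
  qed
  then show ?thesis by (auto simp: agreement_complex_def peaks_def)
qed

text \<open>
The linear form on the left separates a vertex from all others: it is \<open>2\<close> at the vertex itself,
\<open>-2\<close> at its antipode, and \<open>0\<close> elsewhere, as every other vertex matches exactly one of the two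
signs at the corner.
\<close>

lemma corner_sum:
  assumes "V \<subseteq> range r"
  shows "r (Suc k) $ flip k * (\<Sum>V) $ flip k + r (Suc k) $ flip (Suc k) * (\<Sum>V) $ flip (Suc k) =
    2 * (of_bool (r (Suc k) \<in> V) - of_bool (- r (Suc k) \<in> V))"
proof -
  let ?a = "r (Suc k)"
  have fin: "finite V" using assms finite_range finite_subset by blast
  have "?a $ flip k * (\<Sum>V) $ flip k + ?a $ flip (Suc k) * (\<Sum>V) $ flip (Suc k) =
      (\<Sum>Q\<in>V. ?a $ flip k * Q $ flip k + ?a $ flip (Suc k) * Q $ flip (Suc k))"
    by (simp add: sum_component sum_distrib_left sum.distrib)
  also have "\<dots> = (\<Sum>Q\<in>V. (if Q = ?a then 2 else 0) - (if Q = - ?a then 2 else 0))"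
  proof (rule sum.cong[OF refl])
    fix Q assume "Q \<in> V"
    then obtain m where m: "Q = r m" using assms by auto
    have ne: "?a \<noteq> - ?a" using vertex_nonzero[of "Suc k" "flip k"] by (auto simp: vec_eq_iff)
    have 1: "Q = ?a" if "Q $ flip k = ?a $ flip k" "Q $ flip (Suc k) = ?a $ flip (Suc k)"
      using vertex_determined_at_corner that m by simp
    have 2: "Q = - ?a" if "Q $ flip k = - ?a $ flip k" "Q $ flip (Suc k) = - ?a $ flip (Suc k)"
    proof -
      have "r (m + CARD('n)) = ?a"
        by (rule vertex_determined_at_corner) (use that m antipode[of m] in simp_all)
      then show ?thesis using m antipode[of m] by (metis minus_minus)
    qed
    have sgn: "Q $ e = ?a $ e \<or> Q $ e = - ?a $ e" "?a $ e * ?a $ e = 1" for e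
      using vertex_sign[of m e] vertex_sign[of "Suc k" e] m by auto
    consider "Q = ?a" | "Q = - ?a"
      | "Q \<noteq> ?a" "Q \<noteq> - ?a" "Q $ flip k = ?a $ flip k" "Q $ flip (Suc k) = - ?a $ flip (Suc k)"
      | "Q \<noteq> ?a" "Q \<noteq> - ?a" "Q $ flip k = - ?a $ flip k" "Q $ flip (Suc k) = ?a $ flip (Suc k)"
      using 1 2 sgn(1)[of "flip k"] sgn(1)[of "flip (Suc k)"] by metis
    then show "?a $ flip k * Q $ flip k + ?a $ flip (Suc k) * Q $ flip (Suc k) =
        (if Q = ?a then 2 else 0) - (if Q = - ?a then 2 else 0)"
      by cases (use ne sgn(2) in auto)
  qed
  also have "\<dots> = 2 * (of_bool (?a \<in> V) - of_bool (- ?a \<in> V))"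
    using fin by (simp add: sum_subtractf sum.delta')
  finally show ?thesis .
qed

text \<open>
By \<open>corner_sum\<close>, the corner forms take the same values on both sides. These forms separate
vectors: if they all vanish on \<open>S\<close>, then the signed entries \<open>w\<close> of \<open>S\<close> are constant along the
cycle, but they change sign after half a turn.
\<close>

lemma sum_peaks: "\<Sum>peaks = T"
proof -
  define S where "S = \<Sum>peaks - T"
  define w where "w k = r (Suc k) $ flip k * S $ flip k" for k
  have w_Suc: "w (Suc k) = w k" for k
  proof -
    let ?a = "r (Suc k)"
    have sgn: "?a $ e * T $ e = (if e \<in> agreement ?a then 1 else - 1)" for e
      using vertex_sign[of "Suc k" e] T_sign[of e] by (auto simp: agreement_def)
    have "?a $ flip k * (\<Sum>peaks) $ flip k + ?a $ flip (Suc k) * (\<Sum>peaks) $ flip (Suc k) =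
        2 * (of_bool (?a \<in> peaks) - of_bool (- ?a \<in> peaks))"
      by (rule corner_sum) (auto simp: peaks_def)
    also have "\<dots> = ?a $ flip k * T $ flip k + ?a $ flip (Suc k) * T $ flip (Suc k)"
      unfolding peak_iff opposite_peak_iff sgn by auto
    finally have "?a $ flip k * S $ flip k + ?a $ flip (Suc k) * S $ flip (Suc k) = 0"
      by (simp add: S_def algebra_simps)
    then show ?thesis by (simp add: w_def vertex_Suc[of "Suc k"])
  qed
  have w_const: "w (k + i) = w k" for k i by (induction i) (simp_all add: w_Suc)
  have "w (k + CARD('n)) = - w k" for k
    using antipode[of "Suc k"] by (simp add: w_def flip_antipode)
  then have w_0: "w k = 0" for k using w_const[of k "CARD('n)"] by (metis neg_equal_zero)
  have "S $ flip k = 0" for k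
    using w_0[of k] vertex_nonzero[of "Suc k" "flip k"] by (simp add: w_def)
  then have "S = 0" using flip_surj[of 0] by (metis UNIV_I imageE vec_eq_iff zero_index)
  then show ?thesis by (simp add: S_def)
qed

text \<open>
At a peak \<open>Q\<close> the corner form has the value \<open>2\<close> on \<open>T\<close>, so \<open>corner_sum\<close> forces \<open>Q\<close> into every
set of vertices with sum \<open>T\<close>.
\<close>

lemma peaks_subset_decomposition:
  assumes "V \<subseteq> range r" "\<Sum>V = T"
  shows "peaks \<subseteq> V"
proof
  fix Q assume Q: "Q \<in> peaks"
  then have "Q \<in> range r" by (simp add: peaks_def)
  then obtain k where k: "Q = r (Suc k)" by (rule vertex_Suc_cases)
  have "Q $ e * T $ e = 1" if "e \<in> agreement Q" for e
    using that T_sign[of e] by (auto simp: agreement_def)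
  then have "2 = 2 * (of_bool (r (Suc k) \<in> V) - of_bool (- r (Suc k) \<in> V) :: real)"
    using corner_sum[OF assms(1), of k] Q peak_iff[of k] k assms(2) by simp
  then show "Q \<in> V" using k by (auto simp: of_bool_def split: if_splits)
qed

lemma decomposition_eq_peaks:
  assumes "set R = range r"
  shows "decomposition T R = peaks"
  unfolding decomposition_def
proof (rule the_equality)
  have sub: "peaks \<subseteq> range r" by (auto simp: peaks_def)
  show "minimal_decomposition T R peaks"
    unfolding minimal_decomposition_def
  proof (intro conjI allI impI)
    show "\<Sum>Q' \<noteq> T" if "Q' \<subset> peaks" for Q'
      using peaks_subset_decomposition[of Q'] sub that by blast
  qed (use sub sum_peaks assms in auto)
  show "Q = peaks" if "minimal_decomposition T R Q" for Q
  proof -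
    have "peaks \<subseteq> Q" "\<not> peaks \<subset> Q"
      using that peaks_subset_decomposition[of Q] sum_peaks assms
      unfolding minimal_decomposition_def by blast+
    then show ?thesis by blast
  qed
qed

lemma Lambda_complex_eq:
  assumes "set R = range r"
  shows "Lambda_complex T R = agreement_complex"
proof -
  have "UNIV - separation T Q = agreement Q" for Q
    by (auto simp: separation_def agreement_def)
  then show ?thesis
    by (simp add: Lambda_complex_def agreement_complex_eq_peaks decomposition_eq_peaks[OF assms])
qed

subsection \<open>Near-equality with a vertex\<close>

text \<open>
If \<open>e\<close> is not flipped at the corner of a peak, then \<open>r m\<close> and the peak both agree with \<open>T\<close>
there, so they coincide. There is only one vertex at which \<open>e\<close> enters the agreement set, and
only one at which it is about to leave.
\<close>

lemma card_peaks_le_3: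
  assumes "- {e} \<subseteq> agreement (r m)"
  shows "card peaks \<le> 3"
proof -
  define entering where "entering = {r (Suc k) | k. flip k = e \<and> e \<in> agreement (r (Suc k))}"
  define leaving where "leaving = {r (Suc k) | k. flip (Suc k) = e \<and> e \<in> agreement (r (Suc k))}"
  have fin: "finite entering" "finite leaving"
    by (rule finite_subset[OF _ finite_range], force simp: entering_def leaving_def)+
  have "card entering \<le> Suc 0"
    unfolding card_le_Suc0_iff_eq[OF fin(1)]
    by (auto simp: entering_def agreement_def intro!: vertex_determined_by_flip)
  moreover have "card leaving \<le> Suc 0"
    unfolding card_le_Suc0_iff_eq[OF fin(2)]
  proof (intro ballI)
    fix Q Q' assume "Q \<in> leaving" "Q' \<in> leaving"
    then obtain k j where kj: "Q = r (Suc k)" "flip (Suc k) = e" "e \<in> agreement (r (Suc k))"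
        "Q' = r (Suc j)" "flip (Suc j) = e" "e \<in> agreement (r (Suc j))"
      by (auto simp: leaving_def)
    then have "r (Suc (Suc k)) = r (Suc (Suc j))"
      by (intro vertex_determined_by_flip) (simp_all add: vertex_Suc[of "Suc _"] agreement_def)
    then have "r (Suc k) $ g = r (Suc j) $ g" for g
      using vertex_Suc[of "Suc k" g] vertex_Suc[of "Suc j" g] kj by (auto split: if_splits)
    then show "Q = Q'" using kj by (simp add: vec_eq_iff)
  qed
  moreover have "peaks \<subseteq> {r m} \<union> entering \<union> leaving"
  proof
    fix Q assume Q: "Q \<in> peaks"
    then have "Q \<in> range r" by (simp add: peaks_def)
    then obtain k where k: "Q = r (Suc k)" by (rule vertex_Suc_cases)
    then have corner: "flip k \<in> agreement (r (Suc k))" "flip (Suc k) \<in> agreement (r (Suc k))"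
      using Q peak_iff by auto
    show "Q \<in> {r m} \<union> entering \<union> leaving"
    proof (cases "flip k = e \<or> flip (Suc k) = e")
      case True
      then show ?thesis using k corner by (auto simp: entering_def leaving_def)
    next
      case False
      then have "flip k \<in> agreement (r m)" "flip (Suc k) \<in> agreement (r m)" using assms by auto
      then have "r m = r (Suc k)"
        using corner by (intro vertex_determined_at_corner) (simp_all add: agreement_def)
      then show ?thesis using k by simp
    qed
  qed
  then have "card peaks \<le> card ({r m} \<union> entering \<union> leaving)"
    using fin by (intro card_mono) auto
  moreover have "card ({r m} \<union> entering \<union> leaving) \<le> card {r m} + card entering + card leaving"
    using card_Un_le[of "{r m} \<union> entering" leaving] card_Un_le[of "{r m}" entering] by linarith
  ultimately show ?thesis by simp
qed

end

section \<open>Symmetric cycles in the tope graph\<close>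

text \<open>
A zero of a tope could be filled by composing it with a covector that is nonzero there, which
exists as there are no loops.
\<close>

lemma tope_sign:
  assumes M: "simple_oriented_matroid L" and T: "T \<in> topes L"
  shows "T $ e = 1 \<or> T $ e = - 1"
proof -
  interpret oriented_matroid L using M by (simp add: simple_oriented_matroid_def)
  have TL: "T \<in> L" using T by (simp add: topes_def)
  have "T $ e \<noteq> 0"
  proof
    assume "T $ e = 0"
    obtain X where X: "X \<in> L" "X $ e \<noteq> 0"
      using M unfolding simple_oriented_matroid_def om_loop_def by blast
    have "conformal_le T (Defs.composition T X)"
      by (simp add: conformal_le_def composition_def)
    then have "Defs.composition T X = T"
      using T composition[OF TL X(1)] by (simp add: topes_def)
    then have "Defs.composition T X $ e = T $ e" by simp
    then show False using X \<open>T $ e = 0\<close> by (simp add: composition_def)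
  qed
  then show ?thesis using signs TL by (auto simp: sign_vectors_def)
qed

text \<open>
The antipode of a vertex is some \<open>i\<close> steps ahead on the cycle and \<open>2n - i\<close> steps behind. Its
Hamming distance is \<open>n\<close> and each step changes one coordinate, so both numbers are at least
\<open>n\<close>.
\<close>

lemma symmetric_cycle_antipodal:
  fixes L :: "(real ^ 'n) set"
  assumes M: "simple_oriented_matroid L" and R: "symmetric_cycle L R"
  obtains r where "antipodal_cycle r" "set R = range r"
proof -
  define N where "N = CARD('n)"
  define r where "r k = R ! (k mod (2 * N))" for k
  have N: "N > 0" by (simp add: N_def)
  have len: "length R = 2 * N" and sym: "set R = uminus ` set R"
    and adj: "\<And>i. i < 2 * N \<Longrightarrow> tope_adj L (R ! i) (R ! (Suc i mod (2 * N)))"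
    using R by (auto simp: symmetric_cycle_def graph_cycle_def N_def)
  have adj_r: "tope_adj L (r k) (r (Suc k))" for k
    using adj[of "k mod (2 * N)"] N by (simp add: r_def mod_Suc_eq)
  have sign: "r k $ e = 1 \<or> r k $ e = - 1" for k e
    using adj_r[of k] tope_sign[OF M] by (auto simp: tope_adj_def)
  have range: "set R = range r"
  proof
    show "set R \<subseteq> range r"
    proof
      fix Q assume "Q \<in> set R"
      then obtain i where "i < 2 * N" "Q = R ! i" using len by (auto simp: in_set_conv_nth)
      then have "Q = r i" by (simp add: r_def)
      then show "Q \<in> range r" by simp
    qed
    show "range r \<subseteq> set R" using len N by (auto simp: r_def)
  qed
  have hamming: "card {e. r k $ e \<noteq> r (k + i) $ e} \<le> i" for k i
  proof (induction i)
    case (Suc i)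
    obtain f where f: "\<And>e. r (k + i) $ e \<noteq> r (Suc (k + i)) $ e \<Longrightarrow> e = f"
      using adj_r[of "k + i"] by (auto simp: tope_adj_def)
    have "{e. r k $ e \<noteq> r (k + Suc i) $ e} \<subseteq> insert f {e. r k $ e \<noteq> r (k + i) $ e}"
      using f by auto
    then have "card {e. r k $ e \<noteq> r (k + Suc i) $ e} \<le> card (insert f {e. r k $ e \<noteq> r (k + i) $ e})"
      by (intro card_mono) auto
    also have "\<dots> \<le> Suc (card {e. r k $ e \<noteq> r (k + i) $ e})" by (rule card_insert_le_m1) auto
    finally show ?case using Suc by simp
  qed simp
  have opposite: "card {e. r j $ e \<noteq> r k $ e} = N" if "r j = - r k" for j k
  proof -
    have "r j $ e \<noteq> r k $ e" for e using that sign[of k e] by auto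
    then show ?thesis by (simp add: N_def)
  qed
  have "r (k + N) = - r k" for k
  proof -
    have "- r k \<in> range r" using sym range by blast
    then obtain m where m: "- r k = r m" by auto
    obtain i where i: "i < 2 * N" "(k + i) mod (2 * N) = m mod (2 * N)"
      using residue_offset[of "2 * N" k m] N by auto
    then have r_i: "r (k + i) = - r k" using m by (simp add: r_def)
    have "N \<le> i" using opposite[of k "k + i"] hamming[of k i] r_i by simp
    have "r (k + i + (2 * N - i)) = r k" using i by (simp add: r_def)
    then have "N \<le> 2 * N - i"
      using opposite[of "k + i" "k + i + (2 * N - i)"] hamming[of "k + i" "2 * N - i"] r_i by simp
    then have "i = N" using \<open>N \<le> i\<close> N by linarith
    then show ?thesis using r_i by simp
  qed
  then have "antipodal_cycle r"
    using sign adj_r by unfold_locales (auto simp: tope_adj_def N_def)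
  then show thesis using range by (rule that)
qed

theorem proposition2p1:
  fixes L :: "(real ^ 'n) set" and R :: "(real ^ 'n) list" and T :: "real ^ 'n"
    and t :: nat and \<Lambda> :: "'n set set" and f :: "nat \<Rightarrow> nat"
  assumes t: "t = CARD('n)"
    and M: "simple_oriented_matroid L"
    and rank: "om_rank L \<ge> 3"
    and R: "symmetric_cycle L R"
    and T: "T \<in> topes L"
    and Q: "card (decomposition T R) \<ge> 5"
    and Lam: "\<Lambda> = Lambda_complex T R"
    and f: "f = long_f_vector \<Lambda>"
  shows
    "\<Lambda> = Lambda_complex (- T) R \<and>
     \<comment> \<open>(i)\<close>
     (\<forall>j\<le>2. f j = t choose j) \<and>
     f (t - 1) = 0 \<and> f t = 0 \<and>
     (\<Sum>j=3..t. smult (int (t choose j) - int (f j)) ([:-1, 1:] ^ (t - j))) =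
       - (\<Sum>j=3..t. smult ((-1) ^ j * (int (t choose j) - int (f j))) ([:0, 1:] ^ (t - j))) \<and>
     (t = 5 \<longrightarrow>
        int (f 3) = int (t choose 2) - int t \<and> f 3 = 5) \<and>
     (t = 6 \<longrightarrow>
        int (f 3) = int (t choose 3) - 2 * int t + 4 \<and> f 3 = 12 \<and>
        int (f 4) = int (t choose 2) - 3 * int t + 6 \<and> f 4 = 3) \<and>
     (t = 7 \<longrightarrow>
        real (f 3) = 1/2 * real (f 4) + real (t choose 4) - 1/2 * real (t choose 3) \<and>
        real (f 3) = 1/2 * (real (f 4) + 35) \<and>
        int (f 3) = int (f 5) + int (t choose 4) - int (t choose 2) + int t \<and>
        int (f 3) = int (f 5) + 21 \<and>
        int (f 4) = 2 * int (f 3) - 2 * int (t choose 4) + int (t choose 3) \<and>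
        int (f 4) = 2 * int (f 3) - 35 \<and>
        int (f 4) = 2 * int (f 5) + int (t choose 3) - 2 * int (t choose 2) + 2 * int t \<and>
        int (f 4) = 2 * int (f 5) + 7 \<and>
        int (f 5) = int (f 3) - int (t choose 4) + int (t choose 2) - int t \<and>
        int (f 5) = int (f 3) - 21 \<and>
        real (f 5) = 1/2 * real (f 4) - 1/2 * real (t choose 3) + real (t choose 2) - real t \<and>
        real (f 5) = 1/2 * (real (f 4) - 35) + 14 \<and>
        odd (f 4)) \<and>
     \<comment> \<open>(ii)\<close>
     (\<forall>j. 3 \<le> j \<and> j \<le> t - 2 \<longrightarrow>
        int (t choose j) - int (f j) =
          - (\<Sum>i=3..j. (-1) ^ i * int ((t - i) choose (j - i)) * (int (t choose i) - int (f i)))) \<and>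
     \<comment> \<open>(iii)\<close>
     (\<Sum>j=1..t-2. (-1) ^ j * int (f j)) = 0"
proof -
  obtain r where r: "antipodal_cycle r" and range: "set R = range r"
    using symmetric_cycle_antipodal[OF M R] .
  interpret pos: antipodal_cycle_with_sign_vector r T
    using r tope_sign[OF M T]
    by (simp add: antipodal_cycle_with_sign_vector_def antipodal_cycle_with_sign_vector_axioms_def)
  interpret neg: antipodal_cycle_with_sign_vector r "- T"
    using r tope_sign[OF M T]
    by (simp add: antipodal_cycle_with_sign_vector_def antipodal_cycle_with_sign_vector_axioms_def)
      (metis add.inverse_inverse)
  have Lam_pos: "\<Lambda> = pos.agreement_complex" using Lam pos.Lambda_complex_eq[OF range] by simp
  have "neg.agreement (r k) = pos.agreement (r (k + CARD('n)))" for k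
    by (auto simp: neg.agreement_def pos.agreement_def pos.antipode)
  moreover have "pos.agreement (r k) = neg.agreement (r (k + CARD('n)))" for k
    by (auto simp: neg.agreement_def pos.agreement_def pos.antipode)
  ultimately have "pos.agreement_complex = neg.agreement_complex"
    unfolding pos.agreement_complex_def neg.agreement_complex_def by blast
  then have symmetric: "\<Lambda> = Lambda_complex (- T) R"
    using Lam_pos neg.Lambda_complex_eq[OF range] by simp

  define g where "g j = int (t choose j) - int (f j)" for j
  have g_card: "g j = int (card {F. F \<notin> \<Lambda> \<and> card F = j})" for j
    by (simp add: g_def f t long_f_vector_complement)
  have relation: "(\<Sum>i\<le>j. (- 1) ^ i * int ((t - i) choose (j - i)) * g i) = - g j" for j
    unfolding t
  proof (rule nonface_relations[where \<Delta> = \<Lambda>])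
    show "G \<in> \<Lambda>" if "F \<in> \<Lambda>" "G \<subseteq> F" for F G
      using that by (auto simp: Lam_pos pos.agreement_complex_def)
    show "(\<Sum>G | G \<subseteq> H \<and> G \<notin> \<Lambda>. (- 1 :: int) ^ card G) = - 1" if "H \<notin> \<Lambda>" for H
      using that pos.nonface_euler_characteristic by (simp add: Lam_pos)
    show "g i = int (CARD('n) choose i) - int (long_f_vector \<Lambda> i)" for i
      by (simp add: g_def f t)
  qed
  have g_small: "g j = 0" if "j \<le> 2" for j
    using pos.small_sets_in_agreement_complex that by (auto simp: g_card Lam_pos)
  have large: "F \<notin> \<Lambda>" if "card F \<ge> t - 1" for F
  proof
    assume "F \<in> \<Lambda>"
    then obtain k where k: "F \<subseteq> pos.agreement (r k)"
      by (auto simp: Lam_pos pos.agreement_complex_def)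
    have "card (- F) \<le> 1"
      using that by (simp add: t Compl_eq_Diff_UNIV card_Diff_subset)
    then obtain e where "- F \<subseteq> {e}"
      by (metis card_le_Suc0_iff_eq finite One_nat_def subsetI singletonI empty_subsetI ex_in_conv)
    then have "- {e} \<subseteq> pos.agreement (r k)" using k by auto
    then have "card (decomposition T R) \<le> 3"
      using pos.card_peaks_le_3 pos.decomposition_eq_peaks[OF range] by simp
    then show False using Q by simp
  qed
  have f_top: "f (t - 1) = 0" "f t = 0"
    using large by (auto simp: f long_f_vector_def)
  have g_top: "g (t - 1) = int t" "g t = 1"
    using f_top binomial_symmetric[of 1 t] t by (simp_all add: g_def Suc_leI)
  have t4: "t \<ge> 4"
    using g_small[of "t - 1"] g_top(1) t by fastforce

  have f_small: "f j = t choose j" if "j \<le> 2" for j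
    using g_small[OF that] by (simp add: g_def)
  have from_3: "(\<Sum>i\<le>j. h i) = (\<Sum>i=3..j. h i)" if "\<And>i. g i = 0 \<Longrightarrow> h i = 0"
    for h :: "nat \<Rightarrow> 'z :: comm_monoid_add" and j
    using that g_small by (intro sum.mono_neutral_right) auto
  have relation_3: "(\<Sum>i=3..j. (- 1) ^ i * int ((t - i) choose (j - i)) * g i) = - g j" for j
    using relation[of j] by (simp add: from_3)

  have reflection: "(\<Sum>j=3..t. smult (g j) ([:-1, 1:] ^ (t - j))) =
      - (\<Sum>j=3..t. smult ((- 1) ^ j * g j) ([:0, 1:] ^ (t - j)))"
    using polynomial_reflection[of t g, OF relation] by (simp add: from_3)

  have alternating: "(\<Sum>j=1..t-2. (- 1) ^ j * int (f j)) = 0"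
  proof -
    have "(\<Sum>i\<le>t. (- 1) ^ i * int (f i)) = (\<Sum>i\<le>t. (- 1) ^ i * int (t choose i)) - (\<Sum>i\<le>t. (- 1) ^ i * g i)"
      by (simp add: g_def right_diff_distrib sum_subtractf)
    also have "(\<Sum>i\<le>t. (- 1) ^ i * g i) = - 1"
      using relation[of t] g_top by simp
    also have "(\<Sum>i\<le>t. (- 1) ^ i * int (t choose i)) = 0"
      using choose_alternating_sum[of t, where 'a = int] t4 by simp
    finally have "(\<Sum>i\<le>t. (- 1) ^ i * int (f i)) = 1" by simp
    also have "(\<Sum>i\<le>t. (- 1) ^ i * int (f i)) = (\<Sum>i\<in>insert 0 {1..t-2}. (- 1) ^ i * int (f i))"
    proof (rule sum.mono_neutral_right)
      show "\<forall>i\<in>{..t} - insert 0 {1..t-2}. (- 1) ^ i * int (f i) = 0"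
      proof
        fix i assume "i \<in> {..t} - insert 0 {1..t-2}"
        then have "i = t - 1 \<or> i = t" by auto
        then show "(- 1) ^ i * int (f i) = 0" using f_top by auto
      qed
    qed auto
    also have "\<dots> = 1 + (\<Sum>j=1..t-2. (- 1) ^ j * int (f j))"
      using f_small[of 0] by simp
    finally show ?thesis by simp
  qed

  have intervals: "{3..4} = {3, 4 :: nat}" "{3..6} = {3, 4, 5, 6 :: nat}" by auto
  have t5: "f 3 = 5" if "t = 5"
  proof -
    have "2 * g 4 = 2 * g 3"
      using relation_3[of 4] that by (simp add: intervals eval_nat_numeral)
    then have "g 3 = 5" using g_top that by simp
    then show ?thesis using that by (simp add: g_def eval_nat_numeral)
  qed
  have t6: "f 3 = 12 \<and> f 4 = 3" if "t = 6"
  proof -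
    have "2 * g 4 = 3 * g 3" "2 * g 6 = g 3 - g 4 + g 5"
      using relation_3[of 4] relation_3[of 6] that by (simp_all add: intervals eval_nat_numeral)
    then have "g 3 = 8" "g 4 = 12" using g_top that by simp_all
    then show ?thesis using that by (simp add: g_def eval_nat_numeral)
  qed
  have t7: "int (f 4) = 2 * int (f 3) - 35 \<and> int (f 5) = int (f 3) - 21" if "t = 7"
  proof -
    have "g 4 = 2 * g 3" "2 * g 6 = 4 * g 3 - 3 * g 4 + 2 * g 5"
      using relation_3[of 4] relation_3[of 6] that by (simp_all add: intervals eval_nat_numeral)
    moreover have "g 6 = 7" using g_top that by simp
    moreover have "g 3 = 35 - int (f 3)" "g 4 = 35 - int (f 4)" "g 5 = 21 - int (f 5)"
      using that by (simp_all add: g_def eval_nat_numeral)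
    ultimately show ?thesis by simp
  qed
  have binomials: "(5 :: nat) choose 2 = 10" "(6 :: nat) choose 3 = 20" "(6 :: nat) choose 2 = 15"
    "(7 :: nat) choose 4 = 35" "(7 :: nat) choose 3 = 35" "(7 :: nat) choose 2 = 21"
    by (simp_all add: eval_nat_numeral)
  have t7_real: "real (f 4) = 2 * real (f 3) - 35 \<and> real (f 5) = real (f 3) - 21"
    and odd: "odd (f 4)" if "t = 7"
  proof -
    have eq: "f 4 + 35 = 2 * f 3" "f 5 + 21 = f 3" using t7[OF that] by linarith+
    then have "real (f 4 + 35) = real (2 * f 3)" "real (f 5 + 21) = real (f 3)" by simp_all
    then show "real (f 4) = 2 * real (f 3) - 35 \<and> real (f 5) = real (f 3) - 21" by simp
    show "odd (f 4)" using eq(1) by presburger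
  qed
  show ?thesis
  proof (intro conjI allI impI)
    show "(\<Sum>j=3..t. smult (int (t choose j) - int (f j)) ([:-1, 1:] ^ (t - j))) =
        - (\<Sum>j=3..t. smult ((- 1) ^ j * (int (t choose j) - int (f j))) ([:0, 1:] ^ (t - j)))"
      using reflection by (simp add: g_def)
    show "int (t choose j) - int (f j) =
        - (\<Sum>i=3..j. (- 1) ^ i * int ((t - i) choose (j - i)) * (int (t choose i) - int (f i)))" for j
      using relation_3[of j] by (simp add: g_def)
    show "real (f 5) = 1/2 * (real (f 4) - 35) + 14" if "t = 7"
      using t7_real[OF that] by (simp add: field_simps)
  qed (use symmetric f_small f_top t5 t6 t7 t7_real odd alternating binomials in auto)
qed

end
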